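(* Let $K\ge 2$ and $T\ge 1$ be integers. Let $EB$ be the polyhedron of all pairs $(\widetilde X,\widetilde\delta)\in\mathbb{R}^{(K-1)\times T}\times\mathbb{R}^{K\times T}$ satisfying, for the indicated indices, $$\widetilde\delta_{1,t}=\widetilde X_{1,t},\qquad \widetilde\delta_{j,t}=\widetilde X_{j,t}-\widetilde X_{j-1,t}\ \ (j=2,\ldots,K-1),\qquad \widetilde\delta_{K,t}=1-\widetilde X_{K-1,t}\qquad (t=1,\ldots,T),$$ $$\widetilde X_{j,t}\ge \widetilde X_{j,t+1}\qquad (j=1,\ldots,K-1,\ t=1,\ldots,T-1),$$ $$\widetilde X_{j+1,t}\ge \widetilde X_{j,t}\qquad (j=1,\ldots,K-2,\ t=1,\ldots,T),$$ together with the bounds $0\le \widetilde X_{j,t}\le 1$ for $j=1,\ldots,K-1$, $t=1,\ldots,T$, and $0\le\widetilde\delta_{j,t}\le 1$ for $j=1,\ldots,K$, $t=1,\ldots,T$. Then $EB$ is integral.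
   Context: A polytope (bounded polyhedron) is called integral if all of its vertices are integer-valued. Here $T$ is the number of data points and $K$ the number of segments; $\widetilde X$ and $\widetilde \delta$ denote the continuous (LP-relaxed) versions of binary variables. *)

theory Defs
  imports "HOL-Analysis.Analysis"
begin

definition integer_valued :: "'a::euclidean_space \<Rightarrow> bool" where
  "integer_valued x \<longleftrightarrow> (\<forall>b\<in>Basis. x \<bullet> b \<in> \<int>)"

lemma integer_valued_pair_matrix_iff:
  fixes X :: "real ^ 't ^ 'j" and D :: "real ^ 't ^ 'k"
  shows "integer_valued (X, D) \<longleftrightarrow> (\<forall>i t. X $ i $ t \<in> \<int>) \<and> (\<forall>i t. D $ i $ t \<in> \<int>)"
  by (auto simp: integer_valued_def Basis_prod_def Basis_vec_def inner_axis ball_Un)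

definition integral_polytope :: "'a::euclidean_space set \<Rightarrow> bool" where
  "integral_polytope S \<longleftrightarrow> polyhedron S \<and> bounded S \<and> (\<forall>v. v extreme_point_of S \<longrightarrow> integer_valued v)"

(* A (K-1) x T matrix X is a vector of type real ^ 't ^ 'j with CARD('j) = K - 1 and CARD('t) = T,
   and a K x T matrix D one of type real ^ 't ^ 'k with CARD('k) = K. The maps r, s and c number
   the rows of X, the rows of D and the columns of both, starting from 1; they are meant to be
   bijections from {1..K-1}, {1..K} and {1..T} onto the index types. So X $ r j $ c t is the
   entry X_{j,t} and D $ s j $ c t is the entry delta_{j,t}. *)
definition EB :: "nat \<Rightarrow> nat \<Rightarrow> (nat \<Rightarrow> 'j::finite) \<Rightarrow> (nat \<Rightarrow> 'k::finite) \<Rightarrow> (nat \<Rightarrow> 't::finite)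
    \<Rightarrow> ((real ^ 't ^ 'j) \<times> (real ^ 't ^ 'k)) set" where
  "EB K T r s c = {(X, D).
     (\<forall>t\<in>{1..T}. D $ s 1 $ c t = X $ r 1 $ c t) \<and>
     (\<forall>t\<in>{1..T}. \<forall>j\<in>{2..K-1}. D $ s j $ c t = X $ r j $ c t - X $ r (j-1) $ c t) \<and>
     (\<forall>t\<in>{1..T}. D $ s K $ c t = 1 - X $ r (K-1) $ c t) \<and>
     (\<forall>j\<in>{1..K-1}. \<forall>t\<in>{1..T-1}. X $ r j $ c t \<ge> X $ r j $ c (t+1)) \<and>
     (\<forall>j\<in>{1..K-2}. \<forall>t\<in>{1..T}. X $ r (j+1) $ c t \<ge> X $ r j $ c t) \<and>
     (\<forall>j\<in>{1..K-1}. \<forall>t\<in>{1..T}. 0 \<le> X $ r j $ c t \<and> X $ r j $ c t \<le> 1) \<and>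
     (\<forall>j\<in>{1..K}. \<forall>t\<in>{1..T}. 0 \<le> D $ s j $ c t \<and> D $ s j $ c t \<le> 1)}"

end

theory Submission
  imports Defs
begin

text \<open>Integrality follows from a splitting of the unit interval. The maps
  \<open>x \<mapsto> x\<^sup>2\<close> and \<open>x \<mapsto> 2 * x - x\<^sup>2\<close> are nondecreasing on \<open>[0, 1]\<close>, fix \<open>0\<close> and \<open>1\<close>, and
  have the identity as their average. Put a row of zeros before \<open>X\<close> and a row of ones after it
  (\<open>bordered\<close>). Then membership in \<open>EB\<close> says only that the bordered matrix is nondecreasing down
  every column and nonincreasing along every row, and that \<open>D\<close> consists of the successive differences
  of its rows (\<open>mem_EB_iff\<close>). Order and border survive the application of such a map to
  every entry, with \<open>D\<close> recomputed (\<open>EB_map_entries\<close>). So every point \<open>(X, D)\<close> of \<open>EB\<close> is the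
  midpoint of the two points of \<open>EB\<close> obtained from the two maps. At an extreme point they
  coincide, which means \<open>x\<^sup>2 = x\<close> for every entry \<open>x\<close> of \<open>X\<close>: all entries are \<open>0\<close> or \<open>1\<close>, and
  then \<open>D\<close> is integral as well.

  The constraints are finitely many inequalities and equations between affine functionals, so
  \<open>EB\<close> is a polyhedron, and all its coordinates lie in \<open>[0, 1]\<close>.\<close>

section \<open>Polyhedra cut out by affine functionals\<close>

definition affine_functional :: "('a::euclidean_space \<Rightarrow> real) \<Rightarrow> bool" where
  "affine_functional f \<longleftrightarrow> (\<exists>a b. \<forall>x. f x = a \<bullet> x + b)"

lemma affine_functional_const: "affine_functional (\<lambda>x. b)"
  unfolding affine_functional_def by (intro exI[of _ 0] exI[of _ b]) simp

lemma affine_functional_diff: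
  assumes "affine_functional f" "affine_functional g"
  shows "affine_functional (\<lambda>x. f x - g x)"
proof -
  obtain a b a' b' where "\<forall>x. f x = a \<bullet> x + b" "\<forall>x. g x = a' \<bullet> x + b'"
    using assms unfolding affine_functional_def by blast
  then show ?thesis
    unfolding affine_functional_def
    by (intro exI[of _ "a - a'"] exI[of _ "b - b'"]) (simp add: inner_diff_left)
qed

lemma affine_functional_fst_entry:
  "affine_functional (\<lambda>p :: (real ^ 't ^ 'j) \<times> 'b::euclidean_space. fst p $ i $ t)"
  unfolding affine_functional_def
  by (intro exI[of _ "(axis i (axis t 1), 0)"] exI[of _ 0]) (simp add: inner_prod_def inner_axis')

lemma affine_functional_snd_entry:
  "affine_functional (\<lambda>p :: 'b::euclidean_space \<times> (real ^ 't ^ 'k). snd p $ i $ t)"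
  unfolding affine_functional_def
  by (intro exI[of _ "(0, axis i (axis t 1))"] exI[of _ 0]) (simp add: inner_prod_def inner_axis')

lemma polyhedron_affine_le:
  assumes "affine_functional f" "affine_functional g"
  shows "polyhedron {x. f x \<le> g x}"
proof -
  obtain a b where "\<forall>x. f x - g x = a \<bullet> x + b"
    using affine_functional_diff[OF assms] unfolding affine_functional_def by blast
  then have "{x. f x \<le> g x} = {x. a \<bullet> x \<le> - b}"
    by (intro Collect_cong) (smt (verit))
  then show ?thesis by (simp add: polyhedron_halfspace_le)
qed

lemma polyhedron_Collect_conj:
  assumes "polyhedron {x. P x}" "polyhedron {x. Q x}"
  shows "polyhedron {x. P x \<and> Q x}"
  using polyhedron_Int[OF assms] by (simp add: Collect_conj_eq)

lemma polyhedron_Collect_ball: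
  assumes "finite I" "\<And>i. i \<in> I \<Longrightarrow> polyhedron {x. P i x}"
  shows "polyhedron {x. \<forall>i\<in>I. P i x}"
proof -
  have "{x. \<forall>i\<in>I. P i x} = \<Inter> ((\<lambda>i. {x. P i x}) ` I)" by auto
  then show ?thesis using assms by (auto intro!: polyhedron_Inter)
qed

lemma polyhedron_affine_eq:
  assumes "affine_functional f" "affine_functional g"
  shows "polyhedron {x. f x = g x}"
  unfolding order.eq_iff using assms by (intro polyhedron_Collect_conj polyhedron_affine_le)

section \<open>The bordered matrix\<close>

text \<open>Row \<open>0\<close> is zero and all rows from \<open>K\<close> on are one; rows beyond \<open>K\<close> exist so that
  monotonicity in the row index can be stated for all natural numbers.\<close>

definition bordered :: "nat \<Rightarrow> (nat \<Rightarrow> 'j) \<Rightarrow> real ^ 't ^ 'j \<Rightarrow> nat \<Rightarrow> 't \<Rightarrow> real" where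
  "bordered K r X j t = (if j = 0 then 0 else if j < K then X $ r j $ t else 1)"

lemma mono_bordered:
  assumes "\<And>j. j \<in> {1..K} \<Longrightarrow> bordered K r X (j - 1) t \<le> bordered K r X j t"
  shows "mono (\<lambda>j. bordered K r X j t)"
proof (rule monoI, rule lift_Suc_mono_le)
  fix n
  show "bordered K r X n t \<le> bordered K r X (Suc n) t"
    using assms[of "Suc n"] by (cases "Suc n \<le> K") (auto simp: bordered_def)
qed auto

lemma bordered_bounds:
  assumes "0 < K" and "mono (\<lambda>j. bordered K r X j t)"
  shows "bordered K r X j t \<in> {0..1}"
  using monoD[OF assms(2), of 0 j] monoD[OF assms(2), of j "max j K"] assms(1)
  by (auto simp: bordered_def split: if_splits)

lemma affine_functional_bordered:
  "affine_functional (\<lambda>p :: (real ^ 't ^ 'j) \<times> 'b::euclidean_space. bordered K r (fst p) j t)"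
  by (cases "j = 0"; cases "j < K")
    (simp_all add: bordered_def affine_functional_const affine_functional_fst_entry)

lemma bordered_map_entries:
  assumes "\<phi> 0 = 0" "\<phi> 1 = 1"
  shows "bordered K r (\<chi> i t. \<phi> (X $ i $ t)) j t = \<phi> (bordered K r X j t)"
  using assms by (simp add: bordered_def)

text \<open>The three kinds of equation for \<open>D\<close> become a single one, and all bounds in \<open>EB\<close> follow from
  monotonicity, because a column of the bordered matrix climbs from \<open>0\<close> to \<open>1\<close>.\<close>

lemma mem_EB_iff:
  fixes X :: "real ^ 't ^ 'j" and D :: "real ^ 't ^ 'k"
  assumes K: "K \<ge> 2" and c: "bij_betw c {1..T} UNIV"
  shows "(X, D) \<in> EB K T r s c \<longleftrightarrow>
    (\<forall>t. \<forall>j\<in>{1..K}. bordered K r X (j - 1) t \<le> bordered K r X j t \<and>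
        D $ s j $ t = bordered K r X j t - bordered K r X (j - 1) t) \<and>
    (\<forall>j\<in>{1..K-1}. \<forall>t\<in>{1..T-1}. bordered K r X j (c (t + 1)) \<le> bordered K r X j (c t))"
    (is "?L \<longleftrightarrow> ?R")
proof
  assume L: ?L
  have "bordered K r X (j - 1) t \<le> bordered K r X j t \<and>
      D $ s j $ t = bordered K r X j t - bordered K r X (j - 1) t"
    if j: "j \<in> {1..K}" for t j
  proof -
    obtain u where u: "u \<in> {1..T}" "t = c u"
      using c by (metis UNIV_I bij_betw_def imageE)
    have eq: "D $ s j $ t = bordered K r X j t - bordered K r X (j - 1) t"
    proof -
      consider "j = 1" | "j \<in> {2..K-1}" | "j = K" using j by force
      then show ?thesis
        using L u K by cases (auto simp: EB_def bordered_def)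
    qed
    have "0 \<le> D $ s j $ t" using L j u by (auto simp: EB_def)
    with eq show ?thesis by simp
  qed
  moreover have "bordered K r X j (c (t + 1)) \<le> bordered K r X j (c t)"
    if "j \<in> {1..K-1}" "t \<in> {1..T-1}" for j t
    using L that by (auto simp: EB_def bordered_def)
  ultimately show ?R by blast
next
  assume R: ?R
  have m: "mono (\<lambda>j. bordered K r X j t)" for t
    using R by (intro mono_bordered) auto
  have b: "0 \<le> bordered K r X j t" "bordered K r X j t \<le> 1" for j t
    using bordered_bounds[OF _ m, of j t] K by auto
  have X: "X $ r j $ t = bordered K r X j t" if "j \<in> {1..K-1}" for j t
    using that by (auto simp: bordered_def)
  have D: "D $ s j $ t = bordered K r X j t - bordered K r X (j - 1) t" if "j \<in> {1..K}" for j t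
    using R that by blast
  have Z: "bordered K r X 0 t = 0" and O: "bordered K r X K t = 1" for t
    using K by (auto simp: bordered_def)
  have "\<forall>t\<in>{1..T}. D $ s 1 $ c t = X $ r 1 $ c t"
    using K D[of 1] X[of 1] Z by simp
  moreover have "\<forall>t\<in>{1..T}. \<forall>j\<in>{2..K-1}. D $ s j $ c t = X $ r j $ c t - X $ r (j-1) $ c t"
  proof (intro ballI)
    fix t j assume "j \<in> {2..K-1}"
    then have "j \<in> {1..K}" "j \<in> {1..K-1}" "j - 1 \<in> {1..K-1}" by auto
    then show "D $ s j $ c t = X $ r j $ c t - X $ r (j-1) $ c t"
      using D X by simp
  qed
  moreover have "\<forall>t\<in>{1..T}. D $ s K $ c t = 1 - X $ r (K-1) $ c t"
    using K D[of K] X[of "K-1"] O by simp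
  moreover have "\<forall>j\<in>{1..K-1}. \<forall>t\<in>{1..T-1}. X $ r j $ c t \<ge> X $ r j $ c (t+1)"
    using R X by simp
  moreover have "\<forall>j\<in>{1..K-2}. \<forall>t\<in>{1..T}. X $ r (j+1) $ c t \<ge> X $ r j $ c t"
  proof (intro ballI)
    fix j t assume "j \<in> {1..K-2}"
    then have "j \<in> {1..K-1}" "j + 1 \<in> {1..K-1}" by auto
    then show "X $ r (j+1) $ c t \<ge> X $ r j $ c t"
      using X monoD[OF m, of j "j + 1"] by simp
  qed
  moreover have "\<forall>j\<in>{1..K-1}. \<forall>t\<in>{1..T}. 0 \<le> X $ r j $ c t \<and> X $ r j $ c t \<le> 1"
    using X b by simp
  moreover have "0 \<le> D $ s j $ t \<and> D $ s j $ t \<le> 1" if j: "j \<in> {1..K}" for j t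
    using D[OF j, of t] monoD[OF m, of "j - 1" j t] b[of j t] b[of "j-1" t] by linarith
  ultimately show ?L unfolding EB_def by blast
qed

lemma EB_bordered_bounds:
  assumes "K \<ge> 2" and "bij_betw c {1..T} UNIV" and "(X, D) \<in> EB K T r s c"
  shows "bordered K r X j t \<in> {0..1}"
  using assms by (intro bordered_bounds mono_bordered) (auto simp: mem_EB_iff)

section \<open>Integrality\<close>

lemma polyhedron_EB:
  fixes r :: "nat \<Rightarrow> 'j::finite" and s :: "nat \<Rightarrow> 'k::finite" and c :: "nat \<Rightarrow> 't::finite"
  assumes "K \<ge> 2" and "bij_betw c {1..T} UNIV"
  shows "polyhedron (EB K T r s c)"
proof -
  have "EB K T r s c = {p.
    (\<forall>t\<in>UNIV. \<forall>j\<in>{1..K}. bordered K r (fst p) (j - 1) t \<le> bordered K r (fst p) j t \<and>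
        snd p $ s j $ t = bordered K r (fst p) j t - bordered K r (fst p) (j - 1) t) \<and>
    (\<forall>j\<in>{1..K-1}. \<forall>t\<in>{1..T-1}.
        bordered K r (fst p) j (c (t + 1)) \<le> bordered K r (fst p) j (c t))}"
  proof (rule set_eqI)
    fix p :: "(real ^ 't ^ 'j) \<times> (real ^ 't ^ 'k)"
    show "p \<in> EB K T r s c \<longleftrightarrow> p \<in> {p.
      (\<forall>t\<in>UNIV. \<forall>j\<in>{1..K}. bordered K r (fst p) (j - 1) t \<le> bordered K r (fst p) j t \<and>
          snd p $ s j $ t = bordered K r (fst p) j t - bordered K r (fst p) (j - 1) t) \<and>
      (\<forall>j\<in>{1..K-1}. \<forall>t\<in>{1..T-1}.
          bordered K r (fst p) j (c (t + 1)) \<le> bordered K r (fst p) j (c t))}"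
      using mem_EB_iff[OF assms, of "fst p" "snd p" r s] by simp
  qed
  also have "polyhedron \<dots>"
    by (rule polyhedron_Collect_conj;
        rule polyhedron_Collect_ball, simp, rule polyhedron_Collect_ball, simp;
        (rule polyhedron_Collect_conj)?;
        (rule polyhedron_affine_le | rule polyhedron_affine_eq);
        intro affine_functional_diff affine_functional_bordered affine_functional_snd_entry)
  finally show ?thesis .
qed

lemma bounded_EB:
  fixes r :: "nat \<Rightarrow> 'j::finite" and s :: "nat \<Rightarrow> 'k::finite" and c :: "nat \<Rightarrow> 't::finite"
  assumes r: "bij_betw r {1..K-1} UNIV" and s: "bij_betw s {1..K} UNIV"
    and c: "bij_betw c {1..T} UNIV"
  shows "bounded (EB K T r s c)"
proof -
  have all: "(\<forall>i t. 0 \<le> X $ i $ t \<and> X $ i $ t \<le> 1) \<and> (\<forall>i t. 0 \<le> D $ i $ t \<and> D $ i $ t \<le> 1)"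
    if "(X, D) \<in> EB K T r s c" for X D
  proof -
    have "\<forall>j\<in>{1..K-1}. \<forall>t\<in>{1..T}. 0 \<le> X $ r j $ c t \<and> X $ r j $ c t \<le> 1"
      and "\<forall>j\<in>{1..K}. \<forall>t\<in>{1..T}. 0 \<le> D $ s j $ c t \<and> D $ s j $ c t \<le> 1"
      using that unfolding EB_def by blast+
    then show ?thesis
      using r s c by (metis UNIV_I bij_betw_def imageE)
  qed
  have "EB K T r s c \<subseteq> cbox 0 One"
  proof
    fix p assume p: "p \<in> EB K T r s c"
    have "0 \<le> p \<bullet> b \<and> p \<bullet> b \<le> 1" if "b \<in> Basis" for b
      using that all[of "fst p" "snd p"] p
      by (auto simp: Basis_prod_def Basis_vec_def inner_axis inner_prod_def)
    then show "p \<in> cbox 0 One" by (simp add: mem_box)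
  qed
  then show ?thesis using bounded_cbox bounded_subset by blast
qed

text \<open>A map that fixes \<open>0\<close> and \<open>1\<close> respects the border, so mapping the entries of \<open>X\<close> amounts to
  mapping the whole bordered matrix, and a nondecreasing map keeps all inequalities between its
  entries. The matrix \<open>D'\<close> is then forced to be the matrix of row differences.\<close>

lemma EB_map_entries:
  fixes X :: "real ^ 't ^ 'j::finite" and D :: "real ^ 't::finite ^ 'k::finite"
  assumes K: "K \<ge> 2" and s: "bij_betw s {1..K} UNIV" and c: "bij_betw c {1..T} UNIV"
    and XD: "(X, D) \<in> EB K T r s c"
    and \<phi>: "mono_on {0..1} \<phi>" "\<phi> 0 = 0" "\<phi> 1 = 1"
  obtains D' where "((\<chi> i t. \<phi> (X $ i $ t)), D') \<in> EB K T r s c"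
proof
  let ?Y = "\<chi> i t. \<phi> (X $ i $ t)" and ?n = "inv_into {1..K} s"
  let ?D = "\<chi> k t. bordered K r ?Y (?n k) t - bordered K r ?Y (?n k - 1) t"
  have inv: "?n (s j) = j" if "j \<in> {1..K}" for j
    using s that by (simp add: bij_betw_def)
  have le: "bordered K r ?Y i t \<le> bordered K r ?Y j u"
    if "bordered K r X i t \<le> bordered K r X j u" for i j t u
    using that mono_onD[OF \<phi>(1)] EB_bordered_bounds[OF K c XD]
    by (simp only: bordered_map_entries[OF \<phi>(2,3)])
  show "(?Y, ?D) \<in> EB K T r s c"
    unfolding mem_EB_iff[OF K c]
    using XD[unfolded mem_EB_iff[OF K c]] inv by (auto intro!: le simp del: One_nat_def)
qed

lemma extreme_point_of_EB_integer_valued: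
  fixes X :: "real ^ 't ^ 'j::finite" and D :: "real ^ 't::finite ^ 'k::finite"
  assumes K: "K \<ge> 2" and r: "bij_betw r {1..K-1} UNIV" and s: "bij_betw s {1..K} UNIV"
    and c: "bij_betw c {1..T} UNIV"
    and ext: "(X, D) extreme_point_of EB K T r s c"
  shows "integer_valued (X, D)"
proof -
  have XD: "(X, D) \<in> EB K T r s c" using ext by (simp add: extreme_point_of_def)
  define f g :: "real \<Rightarrow> real" where "f x = x\<^sup>2" and "g x = 2 * x - x\<^sup>2" for x
  have f: "mono_on {0..1} f" "f 0 = 0" "f 1 = 1"
    by (auto simp: f_def intro!: mono_onI power_mono)
  have g: "mono_on {0..1} g" "g 0 = 0" "g 1 = 1"
  proof -
    \<comment> \<open>\<open>g x = 1 - (1 - x)\<^sup>2\<close>\<close>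
    have "(1 - y)\<^sup>2 \<le> (1 - x)\<^sup>2" if "x \<le> y" "y \<le> 1" for x y :: real
      using that by (intro power_mono) auto
    then show "mono_on {0..1} g"
      by (auto simp: g_def power2_eq_square algebra_simps intro!: mono_onI)
  qed (auto simp: g_def)
  have avg: "f x + g x = 2 * x" for x by (simp add: f_def g_def)
  let ?F = "\<chi> i t. f (X $ i $ t)" and ?G = "\<chi> i t. g (X $ i $ t)"
  obtain D1 where D1: "(?F, D1) \<in> EB K T r s c" using EB_map_entries[OF K s c XD f] .
  obtain D2 where D2: "(?G, D2) \<in> EB K T r s c" using EB_map_entries[OF K s c XD g] .
  have row: "\<exists>j\<in>{1..K}. k = s j" for k using s by (metis UNIV_I bij_betw_def imageE)
  have diff: "D $ s j $ t = bordered K r X j t - bordered K r X (j - 1) t"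
    if "j \<in> {1..K}" for j t
    using XD that unfolding mem_EB_iff[OF K c] by blast
  \<comment> \<open>\<open>D\<close> depends linearly on the bordered matrix, so it is averaged along with \<open>X\<close>.\<close>
  have "D1 $ k $ t + D2 $ k $ t = 2 * D $ k $ t" for k t
  proof -
    obtain j where j: "j \<in> {1..K}" "k = s j" using row by blast
    have "D1 $ k $ t = f (bordered K r X j t) - f (bordered K r X (j - 1) t)"
      using D1 j unfolding mem_EB_iff[OF K c] bordered_map_entries[of f, OF f(2,3)] by blast
    moreover have "D2 $ k $ t = g (bordered K r X j t) - g (bordered K r X (j - 1) t)"
      using D2 j unfolding mem_EB_iff[OF K c] bordered_map_entries[of g, OF g(2,3)] by blast
    ultimately show ?thesis
      using diff[OF j(1), of t] j(2) avg[of "bordered K r X j t"] avg[of "bordered K r X (j-1) t"]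
      by (simp add: algebra_simps)
  qed
  then have mid: "(X, D) = midpoint (?F, D1) (?G, D2)"
    by (simp add: midpoint_def vec_eq_iff avg flip: distrib_left)
  have "(?F, D1) = (?G, D2)"
    using ext D1 D2 midpoint_in_open_segment unfolding extreme_point_of_def mid by blast
  then have "f (X $ i $ t) = g (X $ i $ t)" for i t by (simp add: vec_eq_iff)
  then have "X $ i $ t * (X $ i $ t - 1) = 0" for i t
    by (simp add: f_def g_def power2_eq_square algebra_simps)
  then have X: "X $ i $ t \<in> \<int>" for i t
    by (metis Ints_0 Ints_1 eq_iff_diff_eq_0 mult_eq_0_iff)
  then have "bordered K r X j t \<in> \<int>" for j t by (simp add: bordered_def)
  then have "D $ k $ t \<in> \<int>" for k t using row[of k] diff by auto
  with X show ?thesis by (simp add: integer_valued_pair_matrix_iff)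
qed

theorem proposition1:
  fixes K T :: nat
    and r :: "nat \<Rightarrow> 'j::finite" and s :: "nat \<Rightarrow> 'k::finite" and c :: "nat \<Rightarrow> 't::finite"
  assumes "K \<ge> 2" and "T \<ge> 1"
    and "bij_betw r {1..K-1} UNIV" and "bij_betw s {1..K} UNIV" and "bij_betw c {1..T} UNIV"
  shows "integral_polytope (EB K T r s c)"
  unfolding integral_polytope_def
proof (intro conjI allI impI)
  show "polyhedron (EB K T r s c)" using assms(1,5) by (rule polyhedron_EB)
  show "bounded (EB K T r s c)" using assms(3,4,5) by (rule bounded_EB)
  fix v assume "v extreme_point_of EB K T r s c"
  then show "integer_valued v"
    using extreme_point_of_EB_integer_valued[OF assms(1,3-5), of "fst v" "snd v"] by simp
qed

end
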